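(* For every integer $m_T\ge1$, $$\alpha(m_T)=\max_{I\in\mathcal{I}(m_T)}\frac{LP[I]}{OPT[I]},$$ where $\mathcal{I}(m_T)$ is the set of instances of \textsc{MaxToll} with exactly $m_T$ toll arcs and $OPT[I]>0$, and $LP[I]$, $OPT[I]$ denote the upper bound and the optimal value of instance $I$.
   Context: \textsc{MaxToll} instance: a directed multigraph $G=(V,A)$ with $A=A_T\cup A_U$ partitioned into toll arcs ($|A_T|=m_T$) and toll-free arcs, fixed costs $c:A_T\to\mathbf{N}$, $d:A_U\to\mathbf{N}$, and vertices $s,t$ such that there is an $s$–$t$ path using only toll-free arcs. Under a nonnegative toll vector $T$ a toll arc $e$ costs $c(e)+T(e)$ and a toll-free arc $e$ costs $d(e)$. $OPT[I]$ is the maximum of $\sum_{e\in A_T\cap P}T(e)$ over nonnegative toll vectors $T$ and simple $s$–$t$ paths $P$ that are shortest with respect to the costs induced by $T$. $LP[I]=\mathcal{L}_\infty-\mathcal{L}_0$, where $\mathcal{L}_\infty$ is the length of a shortest $s$–$t$ path using only toll-free arcs and $\mathcal{L}_0$ is the length of a shortest $s$–$t$ path when all tolls are zero. $\alpha(1)=1$ and, for $k\ge2$, $\alpha(k)=\frac12\max\{1+\alpha(i)+\alpha(j):\ 0<i\le j<k,\ i+j\le k\}$. *)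

theory Defs
  imports Complex_Main
begin

text \<open>A MaxToll instance: a finite directed multigraph whose arcs are identifiers
  with source/target maps, a set of toll arcs, fixed arc costs (c on toll arcs,
  d on toll-free arcs, both stored in one function), and terminals s, t.\<close>

record tinst =
  verts :: "nat set"
  arcs  :: "nat set"
  src   :: "nat \<Rightarrow> nat"
  tgt   :: "nat \<Rightarrow> nat"
  tolls :: "nat set"
  cost  :: "nat \<Rightarrow> nat"
  source :: nat
  sink   :: nat

fun walk :: "tinst \<Rightarrow> nat \<Rightarrow> nat list \<Rightarrow> nat \<Rightarrow> bool" where
  "walk I u [] v = (u = v)"
| "walk I u (e # es) v = (e \<in> arcs I \<and> src I e = u \<and> walk I (tgt I e) es v)"

definition st_path :: "tinst \<Rightarrow> nat list \<Rightarrow> bool" where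
  "st_path I P \<longleftrightarrow> walk I (source I) P (sink I) \<and> distinct (source I # map (tgt I) P)"

definition toll_free :: "tinst \<Rightarrow> nat set" where
  "toll_free I = arcs I - tolls I"

definition wf_instance :: "tinst \<Rightarrow> bool" where
  "wf_instance I \<longleftrightarrow> finite (verts I) \<and> finite (arcs I) \<and> tolls I \<subseteq> arcs I
     \<and> (\<forall>e\<in>arcs I. src I e \<in> verts I \<and> tgt I e \<in> verts I)
     \<and> source I \<in> verts I \<and> sink I \<in> verts I
     \<and> (\<exists>P. st_path I P \<and> set P \<subseteq> toll_free I)"

definition arc_cost :: "tinst \<Rightarrow> (nat \<Rightarrow> real) \<Rightarrow> nat \<Rightarrow> real" where
  "arc_cost I T e = real (cost I e) + (if e \<in> tolls I then T e else 0)"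

definition path_cost :: "tinst \<Rightarrow> (nat \<Rightarrow> real) \<Rightarrow> nat list \<Rightarrow> real" where
  "path_cost I T P = sum_list (map (arc_cost I T) P)"

definition revenue :: "tinst \<Rightarrow> (nat \<Rightarrow> real) \<Rightarrow> nat list \<Rightarrow> real" where
  "revenue I T P = sum_list (map (\<lambda>e. if e \<in> tolls I then T e else 0) P)"

definition shortest :: "tinst \<Rightarrow> (nat \<Rightarrow> real) \<Rightarrow> nat list \<Rightarrow> bool" where
  "shortest I T P \<longleftrightarrow> st_path I P \<and> (\<forall>Q. st_path I Q \<longrightarrow> path_cost I T P \<le> path_cost I T Q)"

definition OPT :: "tinst \<Rightarrow> real" where
  "OPT I = Sup {revenue I T P | T P. (\<forall>e\<in>tolls I. 0 \<le> T e) \<and> shortest I T P}"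

definition dist :: "tinst \<Rightarrow> (nat \<Rightarrow> real) \<Rightarrow> nat set \<Rightarrow> real" where
  "dist I T S = Inf {path_cost I T P | P. st_path I P \<and> set P \<subseteq> S}"

definition L_inf :: "tinst \<Rightarrow> real" where
  "L_inf I = dist I (\<lambda>_. 0) (toll_free I)"

definition L_0 :: "tinst \<Rightarrow> real" where
  "L_0 I = dist I (\<lambda>_. 0) (arcs I)"

definition LP :: "tinst \<Rightarrow> real" where
  "LP I = L_inf I - L_0 I"

fun alpha :: "nat \<Rightarrow> real" where
  "alpha n = (if n \<le> 1 then 1 else
     (1/2) * Max (set [1 + alpha i + alpha j. i \<leftarrow> [1..<n], j \<leftarrow> [i..<n], i + j \<le> n]))"

end

theory Submission
  imports Defs "HOL-Library.Nat_Bijection"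
begin

text \<open>Upper bound: let \<open>P\<close> be a cheapest zero-toll path whose toll arcs all lie in a set \<open>S\<close>. By linear
  programming duality for intervals, the best revenue \<open>R\<close> on \<open>P\<close> equals the extra cost of a cover of
  \<open>P\<close> by toll-free bypasses. Taking the bypasses alternately gives two walks of total cost at most
  \<open>2 cost(P) + R\<close> that use disjoint subsets of \<open>S\<close>. Adding the bounds for the two subsets
  yields the recursion for \<open>alpha\<close>.

  Tightness: put tight instances for \<open>i\<close> and \<open>j\<close> with optimal value \<open>K\<close> in series and add toll-free
  arcs bypassing the first at cost \<open>x\<close> and the second at cost \<open>y\<close>, where \<open>x + y = K\<close>. A shortest path
  either uses a bypass and earns at most \<open>K\<close> in the other part, or it earns at most \<open>x\<close> in the first
  part and \<open>y\<close> in the second. Monotonicity of \<open>alpha\<close> ensures that \<open>x\<close> and \<open>y\<close> are nonnegative,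
  and \<open>K\<close> is a multiple of a power of two to make all costs integral.\<close>

section \<open>The recursion for alpha\<close>

declare alpha.simps [simp del]

lemma alpha_1 [simp]: "alpha (Suc 0) = 1"
  by (simp add: alpha.simps)

lemma alpha_eq_Max:
  assumes "n \<ge> 2"
  shows "alpha n = (1/2) * Max {1 + alpha i + alpha j | i j. 1 \<le> i \<and> i \<le> j \<and> i + j \<le> n}"
proof -
  have "set [1 + alpha i + alpha j. i \<leftarrow> [1..<n], j \<leftarrow> [i..<n], i + j \<le> n]
      = {1 + alpha i + alpha j | i j. 1 \<le> i \<and> i \<le> j \<and> i + j \<le> n}" (is "?L = ?R")
  proof
    show "?L \<subseteq> ?R"
    proof
      fix r assume "r \<in> ?L"
      then obtain i j where "r = 1 + alpha i + alpha j" "1 \<le> i" "i \<le> j" "i + j \<le> n"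
        by auto
      then show "r \<in> ?R" by blast
    qed
    show "?R \<subseteq> ?L"
    proof
      fix r assume "r \<in> ?R"
      then obtain i j where "r = 1 + alpha i + alpha j" "1 \<le> i" "i \<le> j" "i + j \<le> n"
        by auto
      then have "i \<in> {1..<n}" "j \<in> {i..<n}"
          "r \<in> set (if i + j \<le> n then [1 + alpha i + alpha j] else [])"
        by auto
      then show "r \<in> ?L"
        unfolding set_concat set_map set_upt image_image
        by (intro UN_I[where a = i] UN_I[where a = j])
    qed
  qed
  then show ?thesis
    using assms by (subst alpha.simps) simp
qed

lemma finite_alpha_candidates:
  "finite {1 + alpha i + alpha j | i j. 1 \<le> i \<and> i \<le> j \<and> i + j \<le> n}"
  by (rule finite_subset[of _ "(\<lambda>(i, j). 1 + alpha i + alpha j) ` ({..n} \<times> {..n})"]) auto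

text \<open>The bound is symmetric in \<open>i\<close> and \<open>j\<close>, so swapping reduces to
  \<open>i \<le> j\<close>; the two detours of the upper bound come in no particular order.\<close>

lemma alpha_ge_pair:
  assumes "1 \<le> i" "1 \<le> j" "i + j \<le> n"
  shows "(1 + alpha i + alpha j) / 2 \<le> alpha n"
proof -
  have *: "(1 + alpha i + alpha j) / 2 \<le> alpha n"
    if "1 \<le> i" "i \<le> j" "i + j \<le> n" for i j
  proof -
    have "1 + alpha i + alpha j \<le> Max {1 + alpha i + alpha j | i j. 1 \<le> i \<and> i \<le> j \<and> i + j \<le> n}"
      using that by (intro Max_ge finite_alpha_candidates) blast
    then show ?thesis
      using that by (subst alpha_eq_Max) auto
  qed
  show ?thesis
    using *[of i j] *[of j i] assms by (cases "i \<le> j") (auto simp: add_ac)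
qed

lemma alpha_pair_exists:
  assumes "n \<ge> 2"
  obtains i j where "1 \<le> i" "i \<le> j" "i + j \<le> n" "alpha n = (1 + alpha i + alpha j) / 2"
proof -
  have "1 + alpha 1 + alpha 1 \<in> {1 + alpha i + alpha j | i j. 1 \<le> i \<and> i \<le> j \<and> i + j \<le> n}"
    using assms by fastforce
  then have "Max {1 + alpha i + alpha j | i j. 1 \<le> i \<and> i \<le> j \<and> i + j \<le> n}
      \<in> {1 + alpha i + alpha j | i j. 1 \<le> i \<and> i \<le> j \<and> i + j \<le> n}"
    by (intro Max_in finite_alpha_candidates) blast
  then show ?thesis
    using that alpha_eq_Max[OF assms] by auto
qed

lemma alpha_ge_1: "1 \<le> alpha n"
proof (cases "n \<le> 1")
  case True
  then show ?thesis by (simp add: alpha.simps)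
next
  case False
  then show ?thesis using alpha_ge_pair[of 1 1 n] by simp
qed

text \<open>A pair attaining the maximum for \<open>m\<close> is also admissible for
  \<open>n\<close>.\<close>

lemma alpha_mono:
  assumes "1 \<le> m" "m \<le> n"
  shows "alpha m \<le> alpha n"
proof (cases "m = 1")
  case True
  then show ?thesis using alpha_ge_1 by simp
next
  case False
  with assms have "m \<ge> 2" by simp
  then obtain i j where "1 \<le> i" "i \<le> j" "i + j \<le> m" "alpha m = (1 + alpha i + alpha j) / 2"
    by (rule alpha_pair_exists)
  then show ?thesis
    using alpha_ge_pair[of i j n] assms by simp
qed

text \<open>Raising \<open>j\<close> to \<open>m - i\<close> keeps the maximum by monotonicity, so
  all \<open>m\<close> toll arcs get distributed. The last two bounds rearrange
  \<open>alpha j \<le> alpha m\<close> and \<open>alpha i \<le> alpha m\<close>; they will make the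
  bypass costs nonnegative.\<close>

lemma alpha_balanced_pair:
  assumes "m \<ge> 2"
  obtains i j where "1 \<le> i" "1 \<le> j" "i + j = m" "alpha m = (1 + alpha i + alpha j) / 2"
    "alpha j \<le> 1 + alpha i" "alpha i \<le> 1 + alpha j"
proof -
  obtain i j where ij: "1 \<le> i" "i \<le> j" "i + j \<le> m" "alpha m = (1 + alpha i + alpha j) / 2"
    using alpha_pair_exists[OF assms] .
  define j' where "j' = m - i"
  have j': "1 \<le> j'" "i + j' = m" "j \<le> j'" "i \<le> j'"
    using ij by (auto simp: j'_def)
  have "alpha j \<le> alpha j'"
    using ij j' by (intro alpha_mono) auto
  moreover have "(1 + alpha i + alpha j') / 2 \<le> alpha m"
    using ij j' by (intro alpha_ge_pair) auto
  ultimately have eq: "alpha m = (1 + alpha i + alpha j') / 2"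
    using ij by simp
  have "alpha j' \<le> alpha m"
    using j' by (intro alpha_mono) auto
  moreover have "alpha i \<le> alpha m"
    using ij by (intro alpha_mono) auto
  ultimately show ?thesis
    using that[of i j'] ij j' eq by auto
qed

section \<open>Walks\<close>

text \<open>Fixed costs are summed in the naturals, so that cheapest walks exist by
  well-ordering.\<close>

definition len :: "tinst \<Rightarrow> nat list \<Rightarrow> nat" where
  "len I P = sum_list (map (cost I) P)"

lemma len_simps [simp]:
  "len I [] = 0" "len I (e # P) = cost I e + len I P" "len I (P @ Q) = len I P + len I Q"
  by (simp_all add: len_def)

lemma path_cost_simps [simp]:
  "path_cost I T [] = 0" "path_cost I T (e # P) = arc_cost I T e + path_cost I T P"
  "path_cost I T (P @ Q) = path_cost I T P + path_cost I T Q"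
  by (simp_all add: path_cost_def)

lemma revenue_simps [simp]:
  "revenue I T [] = 0" "revenue I T (e # P) = (if e \<in> tolls I then T e else 0) + revenue I T P"
  "revenue I T (P @ Q) = revenue I T P + revenue I T Q"
  by (simp_all add: revenue_def)

lemma path_cost_eq: "path_cost I T P = real (len I P) + revenue I T P"
  by (induction P) (auto simp: arc_cost_def)

lemma revenue_zero [simp]: "revenue I (\<lambda>_. 0) P = 0"
  by (induction P) auto

lemma revenue_toll_free: "set P \<subseteq> toll_free I \<Longrightarrow> revenue I T P = 0"
  by (induction P) (auto simp: toll_free_def)

lemma revenue_nonneg: "\<forall>e\<in>tolls I. 0 \<le> T e \<Longrightarrow> 0 \<le> revenue I T P"
  by (induction P) auto

lemma revenue_ge_toll:
  "\<forall>e\<in>tolls I. 0 \<le> T e \<Longrightarrow> e \<in> set P \<Longrightarrow> e \<in> tolls I \<Longrightarrow> T e \<le> revenue I T P"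
  by (induction P) (auto simp: revenue_nonneg add_increasing add_increasing2)

lemma walk_arcs: "walk I u P v \<Longrightarrow> set P \<subseteq> arcs I"
  by (induction P arbitrary: u) auto

text \<open>Names the vertex at which a walk is cut in two.\<close>

fun walk_end :: "tinst \<Rightarrow> nat \<Rightarrow> nat list \<Rightarrow> nat" where
  "walk_end I u [] = u"
| "walk_end I u (e # P) = walk_end I (tgt I e) P"

lemma walk_end_append [simp]: "walk_end I u (P @ Q) = walk_end I (walk_end I u P) Q"
  by (induction P arbitrary: u) auto

lemma walk_end_eq: "walk I u P v \<Longrightarrow> walk_end I u P = v"
  by (induction P arbitrary: u) auto

lemma walk_append:
  "walk I u (P @ Q) v \<longleftrightarrow> walk I u P (walk_end I u P) \<and> walk I (walk_end I u P) Q v"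
  by (induction P arbitrary: u) auto

lemma walk_appendI: "walk I u P v \<Longrightarrow> walk I v Q w \<Longrightarrow> walk I u (P @ Q) w"
  by (simp add: walk_append walk_end_eq)

lemma simple_walk_suffix:
  assumes "walk I w Q v" "distinct (w # map (tgt I) Q)" "u \<in> set (w # map (tgt I) Q)"
  shows "\<exists>R. walk I u R v \<and> set R \<subseteq> set Q \<and> len I R \<le> len I Q \<and> distinct (u # map (tgt I) R)"
  using assms
proof (induction Q arbitrary: w)
  case Nil
  then show ?case by (intro exI[of _ "[]"]) auto
next
  case (Cons e Q)
  show ?case
  proof (cases "u = w")
    case True
    with Cons.prems show ?thesis by blast
  next
    case False
    with Cons.prems
    have "\<exists>R. walk I u R v \<and> set R \<subseteq> set Q \<and> len I R \<le> len I Q \<and> distinct (u # map (tgt I) R)"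
      by (intro Cons.IH[of "tgt I e"]) auto
    then show ?thesis by fastforce
  qed
qed

text \<open>Cycles are cut out: if \<open>u\<close> recurs on the simplified tail, the suffix from
  there replaces the walk. Costs are natural numbers, so cutting never makes it dearer.\<close>

lemma walk_imp_simple:
  assumes "walk I u P v"
  shows "\<exists>Q. walk I u Q v \<and> set Q \<subseteq> set P \<and> len I Q \<le> len I P \<and> distinct (u # map (tgt I) Q)"
  using assms
proof (induction P arbitrary: u)
  case Nil
  then show ?case by (intro exI[of _ "[]"]) auto
next
  case (Cons e P)
  then obtain Q where Q: "walk I (tgt I e) Q v" "set Q \<subseteq> set P" "len I Q \<le> len I P"
    "distinct (tgt I e # map (tgt I) Q)"
    by fastforce
  show ?case
  proof (cases "u \<in> set (tgt I e # map (tgt I) Q)")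
    case True
    from simple_walk_suffix[OF Q(1,4) True] Q(2,3) show ?thesis
      by fastforce
  next
    case False
    with Q Cons.prems show ?thesis
      by (intro exI[of _ "e # Q"]) auto
  qed
qed

section \<open>Optimal value and distances\<close>

lemma st_path_walk: "st_path I P \<Longrightarrow> walk I (source I) P (sink I)"
  by (simp add: st_path_def)

text \<open>\<open>dist\<close> ranges over simple paths, whereas detours are glued from pieces and
  may repeat vertices; cutting out their cycles makes them comparable.\<close>

lemma dist_le_walk:
  assumes "walk I (source I) W (sink I)" "set W \<subseteq> S"
  shows "dist I (\<lambda>_. 0) S \<le> len I W"
proof -
  obtain Q where Q: "walk I (source I) Q (sink I)" "set Q \<subseteq> set W" "len I Q \<le> len I W"
    "distinct (source I # map (tgt I) Q)"
    using walk_imp_simple[OF assms(1)] by blast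
  have "dist I (\<lambda>_. 0) S \<le> path_cost I (\<lambda>_. 0) Q"
    unfolding dist_def
  proof (rule cInf_lower)
    show "path_cost I (\<lambda>_. 0) Q \<in> {path_cost I (\<lambda>_. 0) P |P. st_path I P \<and> set P \<subseteq> S}"
      using Q assms(2) by (auto simp: st_path_def)
    show "bdd_below {path_cost I (\<lambda>_. 0) P |P. st_path I P \<and> set P \<subseteq> S}"
      by (rule bdd_belowI[of _ 0]) (auto simp: path_cost_eq)
  qed
  also have "\<dots> \<le> len I W"
    using Q(3) by (simp add: path_cost_eq)
  finally show ?thesis .
qed

text \<open>The supremum needs an upper bound: a shortest path costs at most as much as a fixed
  toll-free path, whose cost does not depend on \<open>T\<close>.\<close>

lemma revenue_le_OPT:
  assumes "wf_instance I" "\<forall>e\<in>tolls I. 0 \<le> T e" "shortest I T P"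
  shows "revenue I T P \<le> OPT I"
  unfolding OPT_def
proof (rule cSup_upper)
  show "revenue I T P \<in> {revenue I T P |T P. (\<forall>e\<in>tolls I. 0 \<le> T e) \<and> shortest I T P}"
    using assms by blast
  obtain F where F: "st_path I F" "set F \<subseteq> toll_free I"
    using assms(1) by (auto simp: wf_instance_def)
  show "bdd_above {revenue I T P |T P. (\<forall>e\<in>tolls I. 0 \<le> T e) \<and> shortest I T P}"
  proof (rule bdd_aboveI)
    fix r assume "r \<in> {revenue I T P |T P. (\<forall>e\<in>tolls I. 0 \<le> T e) \<and> shortest I T P}"
    then obtain T P where r: "r = revenue I T P" "shortest I T P"
      by blast
    then have "path_cost I T P \<le> path_cost I T F"
      using F by (auto simp: shortest_def)
    then show "r \<le> real (len I F)"
      using r F by (simp add: path_cost_eq revenue_toll_free)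
  qed
qed

section \<open>Pricing a cheapest path\<close>

text \<open>Toll arcs outside \<open>S\<close> lie off \<open>P\<close> and will be priced out.
  Minimality is over walks, so that \<open>P\<close> can be compared with glued walks
  directly.\<close>

locale cheapest_path =
  fixes I :: tinst and S :: "nat set" and P :: "nat list"
  assumes wf: "wf_instance I"
    and S_tolls: "S \<subseteq> tolls I"
    and P_path: "st_path I P"
    and P_arcs: "set P \<subseteq> toll_free I \<union> S"
    and P_min: "\<And>Q. walk I (source I) Q (sink I) \<Longrightarrow> set Q \<subseteq> toll_free I \<union> S \<Longrightarrow> len I P \<le> len I Q"
begin

section \<open>Positions and segments of the path\<close>

abbreviation "n \<equiv> length P"

definition node :: "nat \<Rightarrow> nat" where
  "node x = walk_end I (source I) (take x P)"

definition pre :: "nat \<Rightarrow> nat" where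
  "pre x = len I (take x P)"

definition seg :: "nat \<Rightarrow> nat \<Rightarrow> nat list" where
  "seg x y = take (y - x) (drop x P)"

lemma P_walk: "walk I (source I) P (sink I)"
  using P_path by (rule st_path_walk)

lemma distinct_P: "distinct P"
  using P_path by (simp add: st_path_def distinct_map)

lemma node_0 [simp]: "node 0 = source I"
  by (simp add: node_def)

lemma node_n [simp]: "node n = sink I"
  using walk_end_eq[OF P_walk] by (simp add: node_def)

lemma pre_0 [simp]: "pre 0 = 0"
  by (simp add: pre_def)

lemma pre_n: "pre n = len I P"
  by (simp add: pre_def)

lemma take_seg: "x \<le> y \<Longrightarrow> take y P = take x P @ seg x y"
  by (metis le_add_diff_inverse seg_def take_add)

lemma walk_take: "walk I (source I) (take x P) (node x)"
  using P_walk walk_append[of I "source I" "take x P" "drop x P" "sink I"] by (simp add: node_def)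

lemma walk_drop: "walk I (node x) (drop x P) (sink I)"
  using P_walk walk_append[of I "source I" "take x P" "drop x P" "sink I"] by (simp add: node_def)

lemma walk_seg: "x \<le> y \<Longrightarrow> walk I (node x) (seg x y) (node y)"
  using walk_take[of y] by (auto simp: take_seg walk_append node_def)

lemma pre_seg: "x \<le> y \<Longrightarrow> pre y = pre x + len I (seg x y)"
  by (simp add: pre_def take_seg)

lemma set_seg: "set (seg x y) \<subseteq> set P"
  unfolding seg_def by (meson order_trans set_drop_subset set_take_subset)

lemma set_seg_take: "x \<le> y \<Longrightarrow> set (seg x y) \<subseteq> set (take y P)"
  by (simp add: take_seg)

lemma seg_disjoint_take:
  assumes "x \<le> y"
  shows "set (take x P) \<inter> set (seg y z) = {}"
proof -
  have "set (take x P) \<inter> set (drop y P) = {}"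
    using assms distinct_P by (rule set_take_disj_set_drop_if_distinct[rotated])
  then show ?thesis
    unfolding seg_def by (meson disjoint_iff in_set_takeD)
qed

lemma seg_Suc: "x < n \<Longrightarrow> seg x (Suc x) = [P ! x]"
  by (simp add: seg_def take_Suc Suc_diff_le hd_drop_conv_nth)

section \<open>Covers by toll-free bypasses\<close>

text \<open>Otherwise, putting \<open>Q\<close> in place of the part of \<open>P\<close> between the
  two positions would give a walk cheaper than \<open>P\<close>.\<close>

lemma subpath_cheapest:
  assumes "walk I (node y) Q (node z)" "set Q \<subseteq> toll_free I \<union> S" "z \<le> n"
  shows "pre z \<le> pre y + len I Q"
proof -
  have "len I P \<le> len I (take y P @ Q @ drop z P)"
  proof (rule P_min)
    show "walk I (source I) (take y P @ Q @ drop z P) (sink I)"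
      using walk_take walk_drop assms(1) by (blast intro: walk_appendI)
    show "set (take y P @ Q @ drop z P) \<subseteq> toll_free I \<union> S"
      using assms(2) P_arcs set_take_subset[of y P] set_drop_subset[of z P] by auto
  qed
  moreover have "len I P = pre z + len I (drop z P)"
    by (simp add: pre_def flip: len_simps(3))
  ultimately show ?thesis
    by (simp add: pre_def)
qed

text \<open>A derivation of \<open>chain x d\<close> is a cover of the first \<open>x\<close> arcs of \<open>P\<close> by intervals that can
  be bypassed toll-free; \<open>d\<close> is the total extra cost of the bypasses. The least such \<open>d\<close> solves
  the linear program of maximising the tolls collected on these arcs.\<close>

inductive chain :: "nat \<Rightarrow> nat \<Rightarrow> bool" where
  chain_0: "chain 0 0"
| chain_step: "chain y d \<Longrightarrow> y < x \<Longrightarrow> x \<le> z \<Longrightarrow> z \<le> n \<Longrightarrow> walk I (node y) Q (node z)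
    \<Longrightarrow> set Q \<subseteq> toll_free I \<Longrightarrow> chain x (d + (pre y + len I Q - pre z))"

text \<open>The optimal value of the covering problem; its increments along \<open>P\<close> become
  the tolls.\<close>

definition D :: "nat \<Rightarrow> nat" where
  "D x = (LEAST d. chain x d)"

text \<open>The toll-free path of the instance bypasses all of \<open>P\<close> at once.\<close>

lemma chain_exists:
  assumes "x \<le> n"
  shows "\<exists>d. chain x d"
proof (cases "x = 0")
  case True
  then show ?thesis using chain_0 by blast
next
  case False
  obtain F where "st_path I F" "set F \<subseteq> toll_free I"
    using wf by (auto simp: wf_instance_def)
  then show ?thesis
    using chain_step[OF chain_0, of x n F] False assms by (auto simp: st_path_def)
qed

lemma chain_D: "x \<le> n \<Longrightarrow> chain x (D x)"
  unfolding D_def using chain_exists by (auto intro: LeastI_ex)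

lemma D_le: "chain x d \<Longrightarrow> D x \<le> d"
  unfolding D_def by (rule Least_le)

lemma D_0 [simp]: "D 0 = 0"
  using D_le[OF chain_0] by simp

text \<open>The sum of \<open>pre\<close> and \<open>D\<close> is a potential that rises along a
  bypass by at most its length: append the bypass to a best cover up to \<open>y\<close>. By
  \<open>subpath_cheapest\<close> the subtraction of naturals in \<open>chain\<close> does not
  truncate here.\<close>

lemma D_bypass:
  assumes "y \<le> z" "z \<le> n" "walk I (node y) Q (node z)" "set Q \<subseteq> toll_free I"
  shows "pre z + D z \<le> pre y + len I Q + D y"
proof -
  have "pre z \<le> pre y + len I Q"
    using assms by (intro subpath_cheapest) auto
  moreover have "D z \<le> D y + (pre y + len I Q - pre z)" if "y < z"
    using assms that by (intro D_le chain_step chain_D) auto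
  ultimately show ?thesis
    using assms(1) by (cases "y = z") auto
qed

lemma D_Suc_mono:
  assumes "Suc x \<le> n"
  shows "D x \<le> D (Suc x)"
  using chain_D[OF assms]
proof (cases rule: chain.cases)
  case (chain_step y d z Q)
  show ?thesis
  proof (cases "y = x")
    case True
    with chain_step show ?thesis
      using D_le[of x d] by simp
  next
    case False
    with chain_step have "chain x (D (Suc x))"
      using chain.chain_step[of y d x z Q] by simp
    then show ?thesis by (rule D_le)
  qed
qed

lemma D_mono: "x \<le> y \<Longrightarrow> y \<le> n \<Longrightarrow> D x \<le> D y"
proof (induction y rule: dec_induct)
  case (step y)
  then show ?case using D_Suc_mono[of y] by simp
qed simp

lemma nth_P:
  assumes "x < n"
  shows "src I (P ! x) = node x" "tgt I (P ! x) = node (Suc x)" "pre (Suc x) = pre x + cost I (P ! x)"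
  using walk_seg[of x "Suc x"] pre_seg[of x "Suc x"] assms by (auto simp: seg_Suc)

text \<open>A toll-free arc of \<open>P\<close> bypasses itself at no extra cost.\<close>

lemma D_toll_free_arc:
  assumes "x < n" "P ! x \<notin> tolls I"
  shows "D (Suc x) = D x"
proof -
  have "P ! x \<in> toll_free I"
    using assms P_walk[THEN walk_arcs] by (auto simp: toll_free_def)
  then have "pre (Suc x) + D (Suc x) \<le> pre x + len I (seg x (Suc x)) + D x"
    using assms by (intro D_bypass walk_seg) (auto simp: seg_Suc)
  then show ?thesis
    using D_Suc_mono[of x] pre_seg[of x "Suc x"] assms by simp
qed

section \<open>Tolls from a minimal cover\<close>

text \<open>Charging the increments of \<open>D\<close> on \<open>P\<close> yields the telescoping
  revenue \<open>D n\<close>, and the potential inequality keeps \<open>P\<close> shortest.\<close>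

lemma D_le_OPT: "D n \<le> OPT I"
proof -
  \<comment> \<open>\<open>THE\<close> recovers the position of \<open>e\<close>, unique because
    \<open>P\<close> is simple. Off \<open>P\<close> the toll is the whole tolled cost of
    \<open>P\<close>, so no path gains by using such an arc.\<close>
  define T where "T e = (if e \<in> set P then let x = (THE x. x < n \<and> P ! x = e) in
      real (D (Suc x)) - real (D x) else real (pre n + D n))" for e
  have T_nth: "T (P ! x) = real (D (Suc x)) - real (D x)" if "x < n" for x
  proof -
    have "(THE y. y < n \<and> P ! y = P ! x) = x"
      using that distinct_P by (auto simp: nth_eq_iff_index_eq)
    then show ?thesis using that by (simp add: T_def)
  qed
  have T_nonneg: "0 \<le> T e" for e
  proof (cases "e \<in> set P")
    case True
    then obtain x where "x < n" "P ! x = e"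
      by (auto simp: in_set_conv_nth)
    then show ?thesis
      using T_nth D_Suc_mono[of x] by auto
  qed (simp add: T_def)
  have rev_nth: "(if P ! x \<in> tolls I then T (P ! x) else 0) = real (D (Suc x)) - real (D x)"
    if "x < n" for x
    using that T_nth D_toll_free_arc by auto
  have rev: "revenue I T (take x P) = D x" if "x \<le> n" for x
    using that
  proof (induction x)
    case (Suc x)
    then show ?case
      using rev_nth[of x] by (simp add: take_Suc_conv_app_nth)
  qed simp
  have rev_P: "revenue I T P = D n"
    using rev[of n] by simp
  \<comment> \<open>\<open>Q\<close> is the rest of a path, and \<open>R\<close> the toll-free
    stretch read since it left \<open>P\<close> at position \<open>y\<close>. A toll-free arc
    extends \<open>R\<close>; a toll arc \<open>P ! x\<close> ends \<open>R\<close> on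
    \<open>P\<close>, and the count restarts at \<open>Suc x\<close>.\<close>
  have lower: "real (pre n + D n) \<le> real (pre y + D y) + (real (len I R) + path_cost I T Q)"
    if "y \<le> n" "walk I (node y) R u" "set R \<subseteq> toll_free I" "walk I u Q (sink I)"
      "set Q \<inter> tolls I \<subseteq> set P" for y R u Q
    using that
  proof (induction Q arbitrary: y R u)
    case Nil
    then have "pre n + D n \<le> pre y + len I R + D y"
      by (intro D_bypass) auto
    then show ?case by simp
  next
    case (Cons e Q)
    show ?case
    proof (cases "e \<in> tolls I")
      case False
      have "real (pre n + D n) \<le> real (pre y + D y) + (real (len I (R @ [e])) + path_cost I T Q)"
      proof (rule Cons.IH)
        show "walk I (node y) (R @ [e]) (tgt I e)"
          using Cons.prems by (intro walk_appendI[of _ _ R u]) auto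
      qed (use Cons.prems False in \<open>auto simp: toll_free_def\<close>)
      then show ?thesis
        using False by (simp add: arc_cost_def)
    next
      case True
      with Cons.prems have "e \<in> set P" by auto
      then obtain x where x: "x < n" "P ! x = e"
        by (auto simp: in_set_conv_nth)
      have u: "u = node x"
        using Cons.prems x nth_P(1)[of x] by auto
      \<comment> \<open>A forward stretch is a bypass; for a stretch leading back, monotonicity of
        \<open>pre\<close> and \<open>D\<close> suffices.\<close>
      have "pre x + D x \<le> pre y + len I R + D y"
      proof (cases "y \<le> x")
        case True
        then show ?thesis
          using Cons.prems x u by (intro D_bypass) auto
      next
        case False
        then show ?thesis
          using D_mono[of x y] pre_seg[of x y] Cons.prems by simp
      qed
      moreover have "real (pre n + D n) \<le> real (pre (Suc x) + D (Suc x)) + (real (len I []) + path_cost I T Q)"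
        using Cons.prems x nth_P(2)[of x] by (intro Cons.IH[where u = "tgt I e"]) auto
      moreover have "arc_cost I T e = real (pre (Suc x) + D (Suc x)) - real (pre x + D x)"
        using rev_nth[of x] nth_P(3)[of x] x True by (simp add: arc_cost_def)
      ultimately show ?thesis by simp
    qed
  qed
  have "shortest I T P"
    unfolding shortest_def
  proof (intro conjI allI impI)
    fix Q assume "st_path I Q"
    then have Q: "walk I (source I) Q (sink I)"
      by (rule st_path_walk)
    have "real (pre n + D n) \<le> path_cost I T Q"
    proof (cases "set Q \<inter> tolls I \<subseteq> set P")
      case True
      then show ?thesis
        using lower[of 0 "[]" "source I" Q] Q by simp
    next
      case False
      then obtain e where e: "e \<in> set Q" "e \<in> tolls I" "e \<notin> set P"
        by blast
      then have "T e \<le> revenue I T Q"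
        using T_nonneg by (intro revenue_ge_toll) auto
      then show ?thesis
        using e by (simp add: path_cost_eq T_def)
    qed
    then show "path_cost I T P \<le> path_cost I T Q"
      by (simp add: path_cost_eq[of _ _ P] rev_P pre_n)
  qed (rule P_path)
  then have "revenue I T P \<le> OPT I"
    using wf T_nonneg by (intro revenue_le_OPT) auto
  then show ?thesis
    by (simp add: rev_P)
qed

text \<open>The intervals of a cover are bypassed alternately by the two walks, so that a toll arc used
  by one of them lies in an interval that the other one bypasses.\<close>

lemma chain_walks:
  assumes "chain x d"
  shows "x \<le> n \<longrightarrow> (\<exists>A B w. x \<le> w \<and> w \<le> n
    \<and> walk I (source I) A (node x) \<and> walk I (source I) B (node w)
    \<and> set A \<union> set B \<subseteq> toll_free I \<union> S
    \<and> (set A \<union> set B) \<inter> tolls I \<subseteq> set (take x P)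
    \<and> set A \<inter> set B \<inter> tolls I = {}
    \<and> len I A + len I B \<le> pre x + pre w + d)"
  \<comment> \<open>\<open>A\<close> stands at \<open>x\<close> and \<open>B\<close> at a position
    \<open>w\<close> at or ahead of it. Even so, the toll arcs of both lie before \<open>x\<close>,
    since \<open>B\<close> gets ahead only by a bypass.\<close>
  using assms
proof induction
  case chain_0
  show ?case
    by (intro impI exI[of _ "[]"] exI[of _ 0]) auto
next
  case (chain_step y d x z Q)
  show ?case
  proof
    assume "x \<le> n"
    with chain_step obtain A B w where ABw: "y \<le> w" "w \<le> n"
      "walk I (source I) A (node y)" "walk I (source I) B (node w)"
      "set A \<union> set B \<subseteq> toll_free I \<union> S"
      "(set A \<union> set B) \<inter> tolls I \<subseteq> set (take y P)"
      "set A \<inter> set B \<inter> tolls I = {}"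
      "len I A + len I B \<le> pre y + pre w + d"
      by auto
    have take_mono: "set (take y P) \<subseteq> set (take x P)"
      using chain_step.hyps by (intro set_take_subset_set_take) auto
    have Q: "set Q \<inter> tolls I = {}"
      using chain_step.hyps by (auto simp: toll_free_def)
    show "\<exists>A B w. x \<le> w \<and> w \<le> n
    \<and> walk I (source I) A (node x) \<and> walk I (source I) B (node w)
    \<and> set A \<union> set B \<subseteq> toll_free I \<union> S
    \<and> (set A \<union> set B) \<inter> tolls I \<subseteq> set (take x P)
    \<and> set A \<inter> set B \<inter> tolls I = {}
    \<and> len I A + len I B \<le> pre x + pre w + (d + (pre y + len I Q - pre z))"
    proof (cases "w \<le> x")
      \<comment> \<open>The walks swap roles: \<open>B\<close> follows \<open>P\<close> up to
        \<open>x\<close>, and \<open>A\<close> takes \<open>Q\<close> and is then the one ahead. The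
        toll arcs that \<open>B\<close> gains lie after \<open>y\<close>, hence are new to
        \<open>A\<close>.\<close>
      case True
      have "pre z \<le> pre y + len I Q"
        using chain_step.hyps by (intro subpath_cheapest) auto
      moreover have "pre x = pre w + len I (seg w x)"
        using True by (rule pre_seg)
      ultimately have "len I (B @ seg w x) + len I (A @ Q)
          \<le> pre x + pre z + (d + (pre y + len I Q - pre z))"
        using ABw(8) by simp
      moreover have "walk I (source I) (B @ seg w x) (node x)"
        using ABw(4) walk_seg[OF True] by (rule walk_appendI)
      moreover have "walk I (source I) (A @ Q) (node z)"
        using ABw(3) chain_step.hyps by (intro walk_appendI)
      moreover have "set (B @ seg w x) \<union> set (A @ Q) \<subseteq> toll_free I \<union> S"
        using ABw(5) set_seg[of w x] P_arcs chain_step.hyps by auto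
      moreover have "(set (B @ seg w x) \<union> set (A @ Q)) \<inter> tolls I \<subseteq> set (take x P)"
        using ABw(6) take_mono Q set_seg_take[OF True] by auto
      moreover have "set (B @ seg w x) \<inter> set (A @ Q) \<inter> tolls I = {}"
        using ABw(6,7) Q seg_disjoint_take[OF ABw(1), of x] by auto
      ultimately show ?thesis
        using chain_step.hyps by blast
    next
      \<comment> \<open>\<open>B\<close> is already beyond \<open>x\<close>, so only
        \<open>A\<close> moves, along \<open>P\<close>; the extra cost of \<open>Q\<close> is
        slack.\<close>
      case False
      have "y \<le> x" using chain_step.hyps by simp
      note seg = walk_seg[OF this] pre_seg[OF this] set_seg_take[OF this]
      have "len I (A @ seg y x) + len I B \<le> pre x + pre w + (d + (pre y + len I Q - pre z))"
        using ABw(8) seg(2) by simp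
      moreover have "walk I (source I) (A @ seg y x) (node x)"
        using ABw(3) seg(1) by (rule walk_appendI)
      moreover have "set (A @ seg y x) \<union> set B \<subseteq> toll_free I \<union> S"
        using ABw(5) set_seg[of y x] P_arcs by auto
      moreover have "(set (A @ seg y x) \<union> set B) \<inter> tolls I \<subseteq> set (take x P)"
        using ABw(6) take_mono seg(3) by auto
      moreover have "set (A @ seg y x) \<inter> set B \<inter> tolls I = {}"
        using ABw(6,7) seg_disjoint_take[of y y x] by auto
      ultimately show ?thesis
        using False ABw(2,4) by (intro exI[of _ "A @ seg y x"] exI[of _ B] exI[of _ w]) auto
    qed
  qed
qed

text \<open>At \<open>x = n\<close> the leading walk cannot be further ahead, so both walks end at
  the sink.\<close>

lemma detour_walks:
  obtains A B where "walk I (source I) A (sink I)" "walk I (source I) B (sink I)"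
    "set A \<subseteq> toll_free I \<union> S" "set B \<subseteq> toll_free I \<union> S" "set A \<inter> set B \<inter> S = {}"
    "len I A + len I B \<le> 2 * len I P + D n"
proof -
  obtain A B w where "n \<le> w" "w \<le> n"
      "walk I (source I) A (node n)" "walk I (source I) B (node w)"
      "set A \<union> set B \<subseteq> toll_free I \<union> S"
      "set A \<inter> set B \<inter> tolls I = {}"
      "len I A + len I B \<le> pre n + pre w + D n"
    using chain_walks[OF chain_D[of n]] by auto
  moreover from this have "w = n" by simp
  ultimately show ?thesis
    using S_tolls that[of A B] by (auto simp: pre_n)
qed

end

section \<open>The upper bound by induction on the number of usable toll arcs\<close>

text \<open>Stated for subsets \<open>S\<close> because each detour uses only part of the toll arcs;
  \<open>OPT I\<close> stays that of the whole instance throughout the induction.\<close>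

lemma gap_le_alpha_OPT:
  assumes "wf_instance I" "S \<subseteq> tolls I" "S \<noteq> {}"
    "walk I (source I) W (sink I)" "set W \<subseteq> toll_free I \<union> S"
  shows "L_inf I - len I W \<le> alpha (card S) * OPT I"
  using assms(2-)
proof (induction "card S" arbitrary: S W rule: less_induct)
  case less
  have "\<exists>P. (walk I (source I) P (sink I) \<and> set P \<subseteq> toll_free I \<union> S) \<and>
      (\<forall>Q. walk I (source I) Q (sink I) \<and> set Q \<subseteq> toll_free I \<union> S \<longrightarrow> len I P \<le> len I Q)"
    by (rule ex_has_least_nat) (use less.prems in blast)
  then obtain P' where P': "walk I (source I) P' (sink I)" "set P' \<subseteq> toll_free I \<union> S"
    "\<And>Q. walk I (source I) Q (sink I) \<Longrightarrow> set Q \<subseteq> toll_free I \<union> S \<Longrightarrow> len I P' \<le> len I Q"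
    by blast
  then obtain P where P: "walk I (source I) P (sink I)" "set P \<subseteq> set P'" "len I P \<le> len I P'"
    "distinct (source I # map (tgt I) P)"
    using walk_imp_simple[of I "source I" P' "sink I"] by blast
  interpret cheapest_path I S P
  proof
    show "st_path I P" using P by (simp add: st_path_def)
    show "set P \<subseteq> toll_free I \<union> S" using P P' by blast
    show "len I P \<le> len I Q" if "walk I (source I) Q (sink I)" "set Q \<subseteq> toll_free I \<union> S" for Q
      using P'(3)[OF that] P(3) by simp
  qed (use assms less.prems in auto)
  obtain A B where AB: "walk I (source I) A (sink I)" "walk I (source I) B (sink I)"
    "set A \<subseteq> toll_free I \<union> S" "set B \<subseteq> toll_free I \<union> S" "set A \<inter> set B \<inter> S = {}"
    "len I A + len I B \<le> 2 * len I P + D n"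
    by (rule detour_walks)
  have OPT: "real (D n) \<le> OPT I" "0 \<le> OPT I"
    using D_le_OPT by linarith+
  have A_min: "len I P \<le> len I A" and B_min: "len I P \<le> len I B"
    using P_min AB by auto
  have "L_inf I - len I P \<le> alpha (card S) * OPT I"
  proof (cases "set A \<inter> S = {} \<or> set B \<inter> S = {}")
    \<comment> \<open>If one detour is toll-free, its length is at least \<open>L_inf I\<close>,
      while the other is no shorter than \<open>P\<close>; so the gap is at most
      \<open>D n\<close>.\<close>
    case True
    then have "L_inf I \<le> len I A \<or> L_inf I \<le> len I B"
      unfolding L_inf_def using AB by (auto intro!: dist_le_walk)
    then have "L_inf I - len I P \<le> 1 * OPT I"
      using A_min B_min AB(6) OPT(1) by linarith
    also have "\<dots> \<le> alpha (card S) * OPT I"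
      using alpha_ge_1 OPT by (intro mult_right_mono) auto
    finally show ?thesis .
  next
    case False
    have fin: "finite S"
      using wf S_tolls unfolding wf_instance_def by (meson finite_subset)
    define a b where "a = card (set A \<inter> S)" and "b = card (set B \<inter> S)"
    have ab: "1 \<le> a" "1 \<le> b"
      using False fin by (auto simp: a_def b_def Suc_le_eq card_gt_0_iff)
    \<comment> \<open>Both parts are nonempty and disjoint, so each is smaller than \<open>S\<close>
      and the induction hypothesis applies to both detours.\<close>
    have "a + b = card (set A \<inter> S \<union> set B \<inter> S)"
      unfolding a_def b_def using AB(5) by (intro card_Un_disjoint[symmetric]) auto
    also have "\<dots> \<le> card S"
      using fin by (intro card_mono) auto
    finally have sum: "a + b \<le> card S" .
    have "L_inf I - len I A \<le> alpha a * OPT I"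
      unfolding a_def
      using AB ab sum less.prems False by (intro less.hyps) (auto simp: a_def b_def)
    moreover have "L_inf I - len I B \<le> alpha b * OPT I"
      unfolding b_def
      using AB ab sum less.prems False by (intro less.hyps) (auto simp: a_def b_def)
    moreover have "real (len I A) + real (len I B) \<le> 2 * real (len I P) + real (D n)"
      using AB(6) by linarith
    ultimately have "2 * (L_inf I - len I P) \<le> OPT I + alpha a * OPT I + alpha b * OPT I"
      using OPT(1) by (smt (verit))
    then have "L_inf I - len I P \<le> (1 + alpha a + alpha b) / 2 * OPT I"
      by (simp add: field_simps)
    also have "\<dots> \<le> alpha (card S) * OPT I"
      using alpha_ge_pair[OF ab sum] OPT by (intro mult_right_mono) auto
    finally show ?thesis .
  qed
  moreover have "len I P \<le> len I W"
    using P_min less.prems by blast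
  ultimately show ?case by linarith
qed

lemma LP_le_alpha_OPT:
  assumes "wf_instance I" "tolls I \<noteq> {}"
  shows "LP I \<le> alpha (card (tolls I)) * OPT I"
proof -
  have "L_inf I - alpha (card (tolls I)) * OPT I \<le> L_0 I"
    unfolding L_0_def dist_def
  proof (rule cInf_greatest)
    show "{path_cost I (\<lambda>_. 0) P |P. st_path I P \<and> set P \<subseteq> arcs I} \<noteq> {}"
      using assms(1) by (auto simp: wf_instance_def toll_free_def)
    fix r assume "r \<in> {path_cost I (\<lambda>_. 0) P |P. st_path I P \<and> set P \<subseteq> arcs I}"
    then obtain P where "r = len I P" "st_path I P" "set P \<subseteq> arcs I"
      by (auto simp: path_cost_eq)
    moreover from this have "set P \<subseteq> toll_free I \<union> tolls I"
      by (auto simp: toll_free_def)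
    ultimately show "L_inf I - alpha (card (tolls I)) * OPT I \<le> r"
      using gap_le_alpha_OPT[OF assms(1) subset_refl assms(2), of P] by (simp add: st_path_def)
  qed
  then show ?thesis
    by (simp add: LP_def)
qed

section \<open>Tight instances\<close>

text \<open>All vertices of a tight instance lie on a line and all arcs point forward. Decoding an arc
  identifier yields its source, target, toll flag and cost, so that instances can be composed by
  taking unions of arc sets.\<close>

definition arc :: "nat \<Rightarrow> nat \<Rightarrow> bool \<Rightarrow> nat \<Rightarrow> nat" where
  "arc u v \<tau> c = prod_encode (u, prod_encode (v, prod_encode (of_bool \<tau>, c)))"

definition asrc :: "nat \<Rightarrow> nat" where
  "asrc e = fst (prod_decode e)"

definition atgt :: "nat \<Rightarrow> nat" where
  "atgt e = fst (prod_decode (snd (prod_decode e)))"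

definition atoll :: "nat \<Rightarrow> bool" where
  "atoll e \<longleftrightarrow> fst (prod_decode (snd (prod_decode (snd (prod_decode e))))) = 1"

definition acost :: "nat \<Rightarrow> nat" where
  "acost e = snd (prod_decode (snd (prod_decode (snd (prod_decode e)))))"

lemma arc_simps [simp]:
  "asrc (arc u v \<tau> c) = u" "atgt (arc u v \<tau> c) = v" "atoll (arc u v \<tau> c) = \<tau>"
  "acost (arc u v \<tau> c) = c"
  by (simp_all add: arc_def asrc_def atgt_def atoll_def acost_def)

definition line :: "nat set \<Rightarrow> nat \<Rightarrow> nat \<Rightarrow> tinst" where
  "line A a b = \<lparr>verts = {a..b}, arcs = A, src = asrc, tgt = atgt, tolls = {e \<in> A. atoll e},
     cost = acost, source = a, sink = b\<rparr>"

text \<open>Depends on an arc set alone, so that walks of the parts carry over to a composite by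
  monotonicity.\<close>

fun lwalk :: "nat set \<Rightarrow> nat \<Rightarrow> nat list \<Rightarrow> nat \<Rightarrow> bool" where
  "lwalk A u [] v = (u = v)"
| "lwalk A u (e # P) v = (e \<in> A \<and> asrc e = u \<and> lwalk A (atgt e) P v)"

definition lcost :: "nat list \<Rightarrow> nat" where
  "lcost P = sum_list (map acost P)"

definition ltoll :: "(nat \<Rightarrow> real) \<Rightarrow> nat list \<Rightarrow> real" where
  "ltoll T P = sum_list (map (\<lambda>e. if atoll e then T e else 0) P)"

lemma lcost_simps [simp]:
  "lcost [] = 0" "lcost (e # P) = acost e + lcost P" "lcost (P @ Q) = lcost P + lcost Q"
  by (simp_all add: lcost_def)

lemma ltoll_simps [simp]:
  "ltoll T [] = 0" "ltoll T (e # P) = (if atoll e then T e else 0) + ltoll T P"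
  "ltoll T (P @ Q) = ltoll T P + ltoll T Q"
  by (simp_all add: ltoll_def)

lemma lwalk_append: "lwalk A u P v \<Longrightarrow> lwalk A v Q w \<Longrightarrow> lwalk A u (P @ Q) w"
  by (induction P arbitrary: u) auto

lemma lwalk_mono: "lwalk A u P v \<Longrightarrow> A \<subseteq> B \<Longrightarrow> lwalk B u P v"
  by (induction P arbitrary: u) auto

lemma lwalk_arcs: "lwalk A u P v \<Longrightarrow> set P \<subseteq> A"
  by (induction P arbitrary: u) auto

lemma walk_line [simp]: "walk (line A a b) u P v \<longleftrightarrow> lwalk A u P v"
  by (induction P arbitrary: u) (auto simp: line_def)

text \<open>Targets increase strictly along a walk; hence every walk on a line is simple.\<close>

lemma lwalk_forward:
  assumes "lwalk A u P v" "\<And>e. e \<in> A \<Longrightarrow> asrc e < atgt e"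
  shows "distinct (map atgt P) \<and> (\<forall>e\<in>set P. u < atgt e)"
  using assms(1)
proof (induction P arbitrary: u)
  case (Cons e P)
  then have "distinct (map atgt P) \<and> (\<forall>f\<in>set P. atgt e < atgt f)" and "u < atgt e"
    using assms(2)[of e] by auto
  then show ?case by fastforce
qed simp

text \<open>The invariant of the composition, phrased by walks without infima or suprema:
  \<open>L\<close> will be the value of \<open>LP\<close>, since the zero-toll distance is 0, and
  \<open>K\<close> bounds \<open>OPT\<close>.\<close>

definition gadget :: "nat \<Rightarrow> nat \<Rightarrow> nat set \<Rightarrow> nat \<Rightarrow> nat \<Rightarrow> bool" where
  "gadget K L A a b \<longleftrightarrow> a < b \<and> finite A
    \<and> (\<forall>e\<in>A. a \<le> asrc e \<and> asrc e < atgt e \<and> atgt e \<le> b)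
    \<and> (\<exists>P. lwalk A a P b \<and> lcost P = 0)
    \<and> (\<exists>P. lwalk A a P b \<and> (\<forall>e\<in>set P. \<not> atoll e) \<and> lcost P = L)
    \<and> (\<forall>P. lwalk A a P b \<and> (\<forall>e\<in>set P. \<not> atoll e) \<longrightarrow> L \<le> lcost P)
    \<and> (\<forall>T P. lwalk A a P b \<and> (\<forall>Q. lwalk A a Q b \<longrightarrow> lcost P + ltoll T P \<le> lcost Q + ltoll T Q)
        \<longrightarrow> ltoll T P \<le> K)"

text \<open>The competing toll-free arc of cost \<open>K\<close> caps the only toll; this matches
  \<open>alpha 1 = 1\<close>.\<close>

lemma gadget_single: "gadget K K {arc a (Suc a) True 0, arc a (Suc a) False K} a (Suc a)"
  (is "gadget _ _ {?t, ?f} _ _")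
proof -
  have walks: "lwalk {?t, ?f} a P (Suc a) \<longleftrightarrow> P = [?t] \<or> P = [?f]" for P
  proof
    assume P: "lwalk {?t, ?f} a P (Suc a)"
    have nil: "R = []" if "lwalk {?t, ?f} (Suc a) R (Suc a)" for R
      using that by (cases R) auto
    show "P = [?t] \<or> P = [?f]"
    proof (cases P)
      case (Cons e R)
      with P have "e = ?t \<or> e = ?f" "lwalk {?t, ?f} (atgt e) R (Suc a)"
        by auto
      then show ?thesis
        using Cons nil[of R] by auto
    qed (use P in simp)
  qed auto
  have "ltoll T P \<le> K"
    if "P = [?t] \<or> P = [?f]"
      "\<And>Q. Q = [?t] \<or> Q = [?f] \<Longrightarrow> lcost P + ltoll T P \<le> lcost Q + ltoll T Q" for T P
    using that(1) that(2)[of "[?f]"] by auto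
  then show ?thesis
    unfolding gadget_def walks by auto
qed

section \<open>Series composition\<close>

text \<open>\<open>xL\<close> and \<open>yL\<close> make both one-bypass toll-free routes cost
  \<open>L\<close>, \<open>L_le\<close> keeps the route through both parts from being shorter, and
  \<open>xy\<close> caps the revenue on the latter.\<close>

locale series =
  fixes A1 A2 A :: "nat set" and a b1 b x y K L1 L2 L :: nat
  assumes g1: "gadget K L1 A1 a b1" and g2: "gadget K L2 A2 (Suc b1) b"
    and xy: "x + y = K" and xL: "x + L2 = L" and yL: "y + L1 = L" and L_le: "L \<le> L1 + L2"
    and A_def: "A = A1 \<union> A2 \<union> {arc b1 (Suc b1) False 0, arc a (Suc b1) False x, arc b1 b False y}"
begin

abbreviation "N0 \<equiv> arc b1 (Suc b1) False 0"
abbreviation "N1 \<equiv> arc a (Suc b1) False x"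
abbreviation "N2 \<equiv> arc b1 b False y"

lemma A1: "e \<in> A1 \<Longrightarrow> a \<le> asrc e \<and> asrc e < atgt e \<and> atgt e \<le> b1" and ab1: "a < b1"
  using g1 by (auto simp: gadget_def)

lemma A2: "e \<in> A2 \<Longrightarrow> Suc b1 \<le> asrc e \<and> asrc e < atgt e \<and> atgt e \<le> b" and b1b: "Suc b1 < b"
  using g2 by (auto simp: gadget_def)

lemma walk_right: "lwalk A u P b \<Longrightarrow> b1 < u \<Longrightarrow> lwalk A2 u P b"
proof (induction P arbitrary: u)
  case (Cons e P)
  then have "e \<in> A2"
    using A1[of e] ab1 by (auto simp: A_def)
  then show ?case
    using Cons A2[of e] by auto
qed simp

text \<open>No walk takes both bypasses: \<open>N1\<close> lands at \<open>Suc b1\<close>, beyond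
  the start \<open>b1\<close> of \<open>N2\<close>, and arcs only point forward.\<close>

lemma walk_cases:
  assumes "lwalk A a P b"
  obtains P1 P2 where "P = P1 @ N0 # P2" "lwalk A1 a P1 b1" "lwalk A2 (Suc b1) P2 b"
  | P2 where "P = N1 # P2" "lwalk A2 (Suc b1) P2 b"
  | P1 where "P = P1 @ [N2]" "lwalk A1 a P1 b1"
proof -
  have "(\<exists>P1 P2. P = P1 @ N0 # P2 \<and> lwalk A1 u P1 b1 \<and> lwalk A2 (Suc b1) P2 b)
    \<or> (u = a \<and> (\<exists>P2. P = N1 # P2 \<and> lwalk A2 (Suc b1) P2 b))
    \<or> (\<exists>P1. P = P1 @ [N2] \<and> lwalk A1 u P1 b1)"
    if "lwalk A u P b" "u \<le> b1" for u
    using that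
  proof (induction P arbitrary: u)
    case Nil
    then show ?case using b1b by simp
  next
    case (Cons e P)
    then consider "e \<in> A1" | "e = N0" | "e = N1" | "e = N2"
      using A2[of e] by (auto simp: A_def)
    then show ?case
    proof cases
      case 1
      with Cons.prems A1[of e] have e: "asrc e = u" "a < atgt e" "atgt e \<le> b1" "lwalk A (atgt e) P b"
        by auto
      \<comment> \<open>After an arc of \<open>A1\<close> the walk is past \<open>a\<close>, which
        excludes \<open>N1\<close>.\<close>
      from Cons.IH[OF e(4,3)] e(2)
      consider P1 P2 where "P = P1 @ N0 # P2" "lwalk A1 (atgt e) P1 b1" "lwalk A2 (Suc b1) P2 b"
        | P1 where "P = P1 @ [N2]" "lwalk A1 (atgt e) P1 b1"
        by blast
      then show ?thesis
      proof cases
        case (1 P1 P2)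
        then have "e # P = (e # P1) @ N0 # P2" "lwalk A1 u (e # P1) b1"
          using \<open>e \<in> A1\<close> e(1) by auto
        then show ?thesis using 1(3) by blast
      next
        case (2 P1)
        then have "e # P = (e # P1) @ [N2]" "lwalk A1 u (e # P1) b1"
          using \<open>e \<in> A1\<close> e(1) by auto
        then show ?thesis by blast
      qed
    next
      case 2
      then have "e # P = [] @ N0 # P" "lwalk A1 u [] b1" "lwalk A2 (Suc b1) P b"
        using Cons.prems by (auto intro: walk_right)
      then show ?thesis by blast
    next
      case 3
      then have "u = a" "lwalk A2 (Suc b1) P b"
        using Cons.prems by (auto intro: walk_right)
      then show ?thesis using 3 by blast
    next
      case 4
      then have "u = b1" "lwalk A2 b P b"
        using Cons.prems b1b by (auto intro: walk_right)
      then have "P = []"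
        using A2[of "hd P"] by (cases P) auto
      then have "e # P = [] @ [N2]" "lwalk A1 u [] b1"
        using 4 \<open>u = b1\<close> by auto
      then show ?thesis by blast
    qed
  qed
  from this[of a] assms ab1 that show ?thesis by auto
qed

lemma walk_through: "lwalk A1 a P1 b1 \<Longrightarrow> lwalk A2 (Suc b1) P2 b \<Longrightarrow> lwalk A a (P1 @ N0 # P2) b"
  by (rule lwalk_append[where v = b1]) (auto simp: A_def intro: lwalk_mono)

lemma walk_skip_left: "lwalk A2 (Suc b1) P2 b \<Longrightarrow> lwalk A a (N1 # P2) b"
  by (auto simp: A_def intro: lwalk_mono)

lemma walk_skip_right: "lwalk A1 a P1 b1 \<Longrightarrow> lwalk A a (P1 @ [N2]) b"
  by (rule lwalk_append[where v = b1]) (auto simp: A_def intro: lwalk_mono)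

lemma gadget_series: "gadget K L A a b"
  unfolding gadget_def
proof (intro conjI allI impI)
  show "a < b" using ab1 b1b by simp
  show "finite A" using g1 g2 by (simp add: A_def gadget_def)
  show "\<forall>e\<in>A. a \<le> asrc e \<and> asrc e < atgt e \<and> atgt e \<le> b"
    using A1 A2 ab1 b1b by (fastforce simp: A_def)
  obtain P1 P2 where "lwalk A1 a P1 b1" "lcost P1 = 0" "lwalk A2 (Suc b1) P2 b" "lcost P2 = 0"
    using g1 g2 unfolding gadget_def by blast
  then show "\<exists>P. lwalk A a P b \<and> lcost P = 0"
    using walk_through by (intro exI[of _ "P1 @ N0 # P2"]) simp
  obtain P2 where "lwalk A2 (Suc b1) P2 b" "\<forall>e\<in>set P2. \<not> atoll e" "lcost P2 = L2"
    using g2 unfolding gadget_def by blast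
  then show "\<exists>P. lwalk A a P b \<and> (\<forall>e\<in>set P. \<not> atoll e) \<and> lcost P = L"
    using walk_skip_left xL by (intro exI[of _ "N1 # P2"]) simp
next
  fix P assume P: "lwalk A a P b \<and> (\<forall>e\<in>set P. \<not> atoll e)"
  have L1: "L1 \<le> lcost P1" if "lwalk A1 a P1 b1" "\<forall>e\<in>set P1. \<not> atoll e" for P1
    using g1 that unfolding gadget_def by blast
  have L2: "L2 \<le> lcost P2" if "lwalk A2 (Suc b1) P2 b" "\<forall>e\<in>set P2. \<not> atoll e" for P2
    using g2 that unfolding gadget_def by blast
  from P have "lwalk A a P b" ..
  then show "L \<le> lcost P"
  proof (cases rule: walk_cases)
    case (1 P1 P2)
    then show ?thesis using L1[of P1] L2[of P2] P L_le by simp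
  next
    case (2 P2)
    then show ?thesis using L2[of P2] P xL by simp
  next
    case (3 P1)
    then show ?thesis using L1[of P1] P yL by simp
  qed
next
  fix T P
  assume P: "lwalk A a P b \<and> (\<forall>Q. lwalk A a Q b \<longrightarrow> lcost P + ltoll T P \<le> lcost Q + ltoll T Q)"
  have K1: "ltoll T P1 \<le> K"
    if "lwalk A1 a P1 b1" "\<forall>Q. lwalk A1 a Q b1 \<longrightarrow> lcost P1 + ltoll T P1 \<le> lcost Q + ltoll T Q" for P1
    using g1 that unfolding gadget_def by blast
  have K2: "ltoll T P2 \<le> K"
    if "lwalk A2 (Suc b1) P2 b"
      "\<forall>Q. lwalk A2 (Suc b1) Q b \<longrightarrow> lcost P2 + ltoll T P2 \<le> lcost Q + ltoll T Q" for P2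
    using g2 that unfolding gadget_def by blast
  from P have "lwalk A a P b" ..
  then show "ltoll T P \<le> K"
  proof (cases rule: walk_cases)
    case (1 P1 P2)
    \<comment> \<open>Comparison with each bypass caps the tolls of the part that it skips.\<close>
    have "lcost P + ltoll T P \<le> lcost (N1 # P2) + ltoll T (N1 # P2)"
      using P walk_skip_left[OF 1(3)] by blast
    then have "ltoll T P1 \<le> x" using 1(1) by simp
    moreover have "lcost P + ltoll T P \<le> lcost (P1 @ [N2]) + ltoll T (P1 @ [N2])"
      using P walk_skip_right[OF 1(2)] by blast
    then have "ltoll T P2 \<le> y" using 1(1) by simp
    ultimately show ?thesis using 1(1) xy by simp
  next
    case (2 P2)
    \<comment> \<open>Any competitor of \<open>P2\<close> extends by \<open>N1\<close> to a
      competitor of \<open>P\<close>, so \<open>P2\<close> is shortest in the right part.\<close>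
    have "lcost P2 + ltoll T P2 \<le> lcost Q + ltoll T Q" if "lwalk A2 (Suc b1) Q b" for Q
    proof -
      have "lcost P + ltoll T P \<le> lcost (N1 # Q) + ltoll T (N1 # Q)"
        using P walk_skip_left[OF that] by blast
      then show ?thesis using 2(1) by simp
    qed
    then show ?thesis using K2[of P2] 2 by simp
  next
    case (3 P1)
    have "lcost P1 + ltoll T P1 \<le> lcost Q + ltoll T Q" if "lwalk A1 a Q b1" for Q
    proof -
      have "lcost P + ltoll T P \<le> lcost (Q @ [N2]) + ltoll T (Q @ [N2])"
        using P walk_skip_right[OF that] by blast
      then show ?thesis using 3(1) by simp
    qed
    then show ?thesis using K1[of P1] 3 by simp
  qed
qed

text \<open>The new arcs are toll-free, and no arc is common to both parts because they occupy
  disjoint ranges of vertices.\<close>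

lemma card_tolls_series: "card {e \<in> A. atoll e} = card {e \<in> A1. atoll e} + card {e \<in> A2. atoll e}"
proof -
  have "{e \<in> A. atoll e} = {e \<in> A1. atoll e} \<union> {e \<in> A2. atoll e}"
    by (auto simp: A_def)
  moreover have "{e \<in> A1. atoll e} \<inter> {e \<in> A2. atoll e} = {}"
    using A1 A2 by fastforce
  moreover have "finite A1" "finite A2"
    using g1 g2 by (auto simp: gadget_def)
  ultimately show ?thesis
    by (simp add: card_Un_disjoint)
qed

end

section \<open>Integral scaling and the tight construction\<close>

text \<open>Each level of the recursion halves once and lowers the index, so \<open>2 ^ m\<close>
  clears all denominators.\<close>

lemma alpha_scaled_nat:
  fixes K :: nat
  assumes "1 \<le> m" "2 ^ m dvd K"
  shows "\<exists>L::nat. real L = K * alpha m"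
  using assms
proof (induction m arbitrary: K rule: less_induct)
  case (less m)
  show ?case
  proof (cases "m = 1")
    case True
    then show ?thesis by auto
  next
    case False
    with less.prems have "m \<ge> 2" by simp
    then obtain i j where ij: "1 \<le> i" "1 \<le> j" "i + j = m" "alpha m = (1 + alpha i + alpha j) / 2"
      by (rule alpha_balanced_pair)
    obtain q where q: "K = 2 ^ m * q"
      using less.prems by blast
    define K' where "K' = 2 ^ (m - 1) * q"
    have K: "K = 2 * K'"
      using q less.prems by (cases m) (auto simp: K'_def)
    have "2 ^ i dvd K'" "2 ^ j dvd K'"
      unfolding K'_def using ij by (auto intro!: dvd_mult2 le_imp_power_dvd)
    then obtain L1 L2 :: nat where "real L1 = K' * alpha i" "real L2 = K' * alpha j"
      using less.IH[of i K'] less.IH[of j K'] ij by auto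
    then have "real (K' + L1 + L2) = K * alpha m"
      by (simp add: K ij(4) field_simps)
    then show ?thesis by blast
  qed
qed

text \<open>The start \<open>a\<close> varies in the induction because the right part begins at
  \<open>Suc b1\<close>.\<close>

lemma tight_gadget_exists:
  assumes "1 \<le> m" "2 ^ m dvd K" "real L = K * alpha m"
  shows "\<exists>A b. gadget K L A a b \<and> card {e \<in> A. atoll e} = m"
  using assms
proof (induction m arbitrary: L a rule: less_induct)
  case (less m)
  show ?case
  proof (cases "m = 1")
    case True
    let ?A = "{arc a (Suc a) True 0, arc a (Suc a) False K}"
    have "L = K"
      using True less.prems by simp
    moreover have "{e \<in> ?A. atoll e} = {arc a (Suc a) True 0}"
      by auto
    then have "card {e \<in> ?A. atoll e} = 1"
      by simp
    ultimately show ?thesis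
      using True gadget_single[of K a] by blast
  next
    case False
    with less.prems have "m \<ge> 2" by simp
    then obtain i j where ij: "1 \<le> i" "1 \<le> j" "i + j = m" "alpha m = (1 + alpha i + alpha j) / 2"
      "alpha j \<le> 1 + alpha i" "alpha i \<le> 1 + alpha j"
      by (rule alpha_balanced_pair)
    obtain q where q: "K = 2 ^ m * q"
      using less.prems by blast
    define K' where "K' = 2 ^ (m - 1) * q"
    have K: "K = 2 * K'"
      using q less.prems by (cases m) (auto simp: K'_def)
    have dvd: "2 ^ i dvd K'" "2 ^ j dvd K'"
      unfolding K'_def using ij by (auto intro!: dvd_mult2 le_imp_power_dvd)
    \<comment> \<open>Computed at half scale, so that \<open>L\<close> becomes
      \<open>K' + L1 + L2\<close> without division; the parts used below have the doubled
      values.\<close>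
    obtain L1 L2 :: nat where L12: "real L1 = K' * alpha i" "real L2 = K' * alpha j"
      using alpha_scaled_nat[OF ij(1) dvd(1)] alpha_scaled_nat[OF ij(2) dvd(2)] by blast
    have "real L2 \<le> real K' + real L1" "real L1 \<le> real K' + real L2"
      unfolding L12 using mult_left_mono[OF ij(5), of "real K'"] mult_left_mono[OF ij(6), of "real K'"]
      by (simp_all add: distrib_left)
    \<comment> \<open>These bounds keep the natural subtractions in the bypass costs from
      truncating.\<close>
    then have le: "L2 \<le> K' + L1" "L1 \<le> K' + L2"
      by linarith+
    have "real K' \<le> real L1"
      unfolding L12 using mult_left_mono[OF alpha_ge_1, of "real K'" i] by simp
    then have K'_le: "K' \<le> L1" by simp
    have "real L = real (K' + L1 + L2)"
      using less.prems(3) by (simp add: K ij(4) L12 field_simps)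
    then have L: "L = K' + L1 + L2"
      by linarith
    obtain A1 b1 where left: "gadget K (2 * L1) A1 a b1" "card {e \<in> A1. atoll e} = i"
      using less.IH[of i "2 * L1" a] ij dvd by (auto simp: K L12)
    obtain A2 b where right: "gadget K (2 * L2) A2 (Suc b1) b" "card {e \<in> A2. atoll e} = j"
      using less.IH[of j "2 * L2" "Suc b1"] ij dvd by (auto simp: K L12)
    \<comment> \<open>The bypass costs solve \<open>x + y = K\<close> and
      \<open>x + 2 * L2 = y + 2 * L1\<close>.\<close>
    interpret series A1 A2
      "A1 \<union> A2 \<union> {arc b1 (Suc b1) False 0, arc a (Suc b1) False (K' + L1 - L2),
        arc b1 b False (K' + L2 - L1)}"
      a b1 b "K' + L1 - L2" "K' + L2 - L1" K "2 * L1" "2 * L2" L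
      by unfold_locales (use left right le K'_le in \<open>auto simp: K L\<close>)
    show ?thesis
      using gadget_series card_tolls_series left(2) right(2) ij(3) by blast
  qed
qed

section \<open>From gadgets to instances\<close>

lemma line_simps [simp]:
  "verts (line A a b) = {a..b}" "arcs (line A a b) = A" "src (line A a b) = asrc"
  "tgt (line A a b) = atgt" "tolls (line A a b) = {e \<in> A. atoll e}" "cost (line A a b) = acost"
  "source (line A a b) = a" "sink (line A a b) = b"
  by (simp_all add: line_def)

lemma len_line [simp]: "len (line A a b) P = lcost P"
  by (simp add: len_def lcost_def)

lemma revenue_line: "set P \<subseteq> A \<Longrightarrow> revenue (line A a b) T P = ltoll T P"
  by (induction P) auto

text \<open>Since all walks are simple, the clauses of \<open>gadget\<close> speak about exactly the
  paths in \<open>LP\<close> and \<open>OPT\<close>. Only an upper bound on \<open>OPT\<close> is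
  obtained here.\<close>

lemma gadget_instance:
  assumes "gadget K L A a b"
  defines "I \<equiv> line A a b"
  shows "wf_instance I" "LP I = L" "OPT I \<le> K"
proof -
  have fwd: "a < b" "finite A" "\<And>e. e \<in> A \<Longrightarrow> a \<le> asrc e \<and> asrc e < atgt e \<and> atgt e \<le> b"
    using assms(1) by (auto simp: gadget_def)
  have st: "st_path I P \<longleftrightarrow> lwalk A a P b" for P
    using lwalk_forward[of A a P b] fwd(3) by (auto simp: st_path_def I_def)
  have free: "toll_free I = {e \<in> A. \<not> atoll e}"
    by (auto simp: toll_free_def I_def)
  obtain P0 where P0: "lwalk A a P0 b" "lcost P0 = 0"
    using assms(1) unfolding gadget_def by blast
  obtain F where F: "lwalk A a F b" "\<forall>e\<in>set F. \<not> atoll e" "lcost F = L"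
    using assms(1) unfolding gadget_def by blast
  have F_free: "set F \<subseteq> toll_free I"
    using F lwalk_arcs[OF F(1)] by (auto simp: free)
  have F_min: "L \<le> lcost P" if "lwalk A a P b" "set P \<subseteq> toll_free I" for P
    using assms(1) that unfolding gadget_def free by blast
  have arcs: "arcs I = A"
    by (simp add: I_def)
  have cost0: "path_cost I (\<lambda>_. 0) P = lcost P" for P
    by (simp add: path_cost_eq I_def)
  show "wf_instance I"
    using fwd F(1) F_free st unfolding wf_instance_def by (fastforce simp: I_def)
  have "L_inf I = L"
    unfolding L_inf_def dist_def
    by (rule cInf_eq_minimum) (use F F_free F_min in \<open>auto simp: st cost0\<close>)
  moreover have "L_0 I = 0"
    unfolding L_0_def dist_def
    by (rule cInf_eq_minimum) (use P0 lwalk_arcs[OF P0(1)] arcs in \<open>auto simp: st cost0\<close>)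
  ultimately show "LP I = L"
    by (simp add: LP_def)
  show "OPT I \<le> K"
    unfolding OPT_def
  proof (rule cSup_least)
    have "shortest I (\<lambda>_. 0) P0"
      using P0 by (auto simp: shortest_def st cost0)
    then show "{revenue I T P |T P. (\<forall>e\<in>tolls I. 0 \<le> T e) \<and> shortest I T P} \<noteq> {}"
      by fastforce
    fix r assume "r \<in> {revenue I T P |T P. (\<forall>e\<in>tolls I. 0 \<le> T e) \<and> shortest I T P}"
    then obtain T P where r: "r = revenue I T P" "shortest I T P"
      by blast
    have cost: "path_cost I T Q = lcost Q + ltoll T Q" if "lwalk A a Q b" for Q
      using revenue_line[OF lwalk_arcs[OF that]] by (simp add: path_cost_eq I_def)
    have P: "lwalk A a P b"
      using r(2) by (simp add: shortest_def st)
    moreover have "\<forall>Q. lwalk A a Q b \<longrightarrow> lcost P + ltoll T P \<le> lcost Q + ltoll T Q"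
      using r(2) cost P by (simp add: shortest_def st)
    ultimately have "ltoll T P \<le> K"
      using assms(1) unfolding gadget_def by blast
    then show "r \<le> K"
      using revenue_line[OF lwalk_arcs[OF P]] by (simp add: r(1) I_def)
  qed
qed

theorem theorem7:
  fixes m :: nat
  assumes "m \<ge> 1"
  shows "(\<forall>I. wf_instance I \<and> card (tolls I) = m \<and> OPT I > 0 \<longrightarrow> LP I / OPT I \<le> alpha m)
       \<and> (\<exists>I. wf_instance I \<and> card (tolls I) = m \<and> OPT I > 0 \<and> LP I / OPT I = alpha m)"
proof (intro conjI allI impI)
  fix I assume I: "wf_instance I \<and> card (tolls I) = m \<and> OPT I > 0"
  then have "tolls I \<noteq> {}"
    using assms by auto
  then have "LP I \<le> alpha m * OPT I"
    using LP_le_alpha_OPT[of I] I by simp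
  then show "LP I / OPT I \<le> alpha m"
    using I by (simp add: divide_le_eq)
next
  define K :: nat where "K = 2 ^ m"
  obtain L :: nat where L: "real L = K * alpha m"
    using alpha_scaled_nat[of m K] assms by (auto simp: K_def)
  obtain A b where A: "gadget K L A 0 b" "card {e \<in> A. atoll e} = m"
    using tight_gadget_exists[of m K L 0] assms L by (auto simp: K_def)
  define I where "I = line A 0 b"
  note I = gadget_instance[OF A(1), folded I_def]
  have card: "card (tolls I) = m"
    by (simp add: I_def A(2))
  then have "tolls I \<noteq> {}"
    using assms by auto
  \<comment> \<open>The general upper bound itself forces \<open>OPT I\<close> up to
    \<open>K\<close>, so no optimal tolls have to be exhibited.\<close>
  then have "K * alpha m \<le> alpha m * OPT I"
    using LP_le_alpha_OPT[OF I(1)] I(2) L card by simp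
  then have "K \<le> OPT I"
    using alpha_ge_1[of m] by (simp add: mult.commute)
  with I(3) have OPT: "OPT I = K" by simp
  moreover have "K > 0"
    by (simp add: K_def)
  ultimately have "OPT I > 0" "LP I / OPT I = alpha m"
    using I(2) L by auto
  with I(1) card
  show "\<exists>I. wf_instance I \<and> card (tolls I) = m \<and> OPT I > 0 \<and> LP I / OPT I = alpha m"
    by blast
qed

end
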